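(* Let $G$ be a graph with a proper $(c+1)$-coloring $V(G)=\bigsqcup_{i=0}^{c}V_i$. Write $T=G\setminus V_0$ for the induced subgraph of $G$ on $V_1\cup\dots\cup V_c$, and $H_i=G[V_0\cup V_i]$ for $1\le i\le c$. Suppose the following hold. - $T$ is Hoffman colorable with $c$ colors (i.e. $T$ is Hoffman colorable and $\chi(T)=c$), with positive eigenvector $x$. - For every $1\le i\le c$ we have $\lambda_{\min}(T)=\lambda_{\min}(H_i)$. - There exists a vector $y:V_0\to\mathbb{R}_{>0}$ such that for every $1\le i\le c$ the vector $x|_{V_i}\sqcup y$ is a positive eigenvector of $H_i$. Put $\nu=-\lambda_{\min}(T)$. Then $x\sqcup y$ is a positive eigenvector of $G$ for the eigenvalue $c\nu$. Furthermore, the following are equivalent. (i) $G$ is Hoffman colorable with $c+1$ colors (i.e. $G$ is Hoffman colorable and $\chi(G)=c+1$); (ii) $\lambda_{\min}(G)=\lambda_{\min}(T)$; (iii) There exists no eigenvector $z$ of $G$ for an eigenvalue less than $\lambda_{\min}(T)$ such that $z|_{V_0}$ is orthogonal to $y$ and $z|_{V_i}$ is orthogonal to $x|_{V_i}$ for all $1\le i\le c$.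
   Context: All graphs are finite, simple and undirected. $\lambda_{\max}(G)$ and $\lambda_{\min}(G)$ denote the largest and smallest eigenvalues of the adjacency matrix of $G$; $\chi(G)$ is the chromatic number. An eigenvector of $G$ means an eigenvector of its adjacency matrix, viewed as a function on $V(G)$; a positive eigenvector is one all of whose entries are positive. For a graph with at least one edge, Hoffman's bound states $\chi(G)\ge h(G):=1-\lambda_{\max}(G)/\lambda_{\min}(G)$. A connected graph $G$ with at least one edge is called Hoffman colorable if $\chi(G)=h(G)$ (without rounding). A disconnected graph is called Hoffman colorable if every connected component is Hoffman colorable and the values $\lambda_{\max}$, $\lambda_{\min}$ and $\chi$ are the same for all components. With this convention every Hoffman colorable graph has a positive eigenvector. $G[U]$ denotes the induced subgraph on $U$. For functions $x:A\to D$ and $y:B\to D$ with $A,B$ disjoint, $x\sqcup y:A\sqcup B\to D$ is the function that agrees with $x$ on $A$ and with $y$ on $B$. *)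

theory Defs
  imports Complex_Main "Graph_Theory.Digraph_Component"
begin

text \<open>
  Following \<open>Graph_Theory\<close>, a finite simple undirected graph is a \<open>pre_digraph\<close> in the locale
  \<open>graph\<close>: a finite loop-free digraph without parallel arcs whose arc relation is symmetric, so
  each edge appears as a pair of opposite arcs. For such a graph the strongly connected components
  \<open>sccs\<close> are the connected components.
\<close>

definition adjacency_matrix :: "('a, 'b) pre_digraph \<Rightarrow> 'a \<Rightarrow> 'a \<Rightarrow> real" where
  "adjacency_matrix G u v = (if u \<rightarrow>\<^bsub>G\<^esub> v then 1 else 0)"

text \<open>
  Vectors on \<open>V(G)\<close> are total functions of which only the values on \<open>verts G\<close> matter. Thus a
  function defined on a larger vertex set also stands for its restriction to \<open>verts G\<close>.
  Adjacency matrices are real symmetric, so real eigenvalues and eigenvectors suffice.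
\<close>

definition graph_eigenvector :: "('a, 'b) pre_digraph \<Rightarrow> real \<Rightarrow> ('a \<Rightarrow> real) \<Rightarrow> bool" where
  "graph_eigenvector G \<theta> f \<longleftrightarrow>
     (\<exists>v\<in>verts G. f v \<noteq> 0) \<and>
     (\<forall>u\<in>verts G. (\<Sum>v\<in>verts G. adjacency_matrix G u v * f v) = \<theta> * f u)"

definition positive_graph_eigenvector :: "('a, 'b) pre_digraph \<Rightarrow> real \<Rightarrow> ('a \<Rightarrow> real) \<Rightarrow> bool" where
  "positive_graph_eigenvector G \<theta> f \<longleftrightarrow> graph_eigenvector G \<theta> f \<and> (\<forall>v\<in>verts G. f v > 0)"

definition graph_eigenvalues :: "('a, 'b) pre_digraph \<Rightarrow> real set" where
  "graph_eigenvalues G = {\<theta>. \<exists>f. graph_eigenvector G \<theta> f}"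

text \<open>The eigenvalues form a finite set, nonempty unless \<open>verts G = {}\<close>; on the graph without
  vertices the next two constants are unspecified.\<close>

definition max_graph_eigenvalue :: "('a, 'b) pre_digraph \<Rightarrow> real" where
  "max_graph_eigenvalue G = Max (graph_eigenvalues G)"

definition min_graph_eigenvalue :: "('a, 'b) pre_digraph \<Rightarrow> real" where
  "min_graph_eigenvalue G = Min (graph_eigenvalues G)"

definition proper_coloring :: "('a, 'b) pre_digraph \<Rightarrow> nat \<Rightarrow> ('a \<Rightarrow> nat) \<Rightarrow> bool" where
  "proper_coloring G k col \<longleftrightarrow>
     (\<forall>v\<in>verts G. col v < k) \<and> (\<forall>u v. u \<rightarrow>\<^bsub>G\<^esub> v \<longrightarrow> col u \<noteq> col v)"

definition color_class :: "('a, 'b) pre_digraph \<Rightarrow> ('a \<Rightarrow> nat) \<Rightarrow> nat \<Rightarrow> 'a set" where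
  "color_class G col i = {v \<in> verts G. col v = i}"

definition chromatic_number :: "('a, 'b) pre_digraph \<Rightarrow> nat" where
  "chromatic_number G = (LEAST k. \<exists>col. proper_coloring G k col)"

definition hoffman_bound :: "('a, 'b) pre_digraph \<Rightarrow> real" where
  "hoffman_bound G = 1 - max_graph_eigenvalue G / min_graph_eigenvalue G"

definition connected_hoffman_colorable :: "('a, 'b) pre_digraph \<Rightarrow> bool" where
  "connected_hoffman_colorable G \<longleftrightarrow>
     Digraph_Component.connected G \<and> arcs G \<noteq> {} \<and> real (chromatic_number G) = hoffman_bound G"

text \<open>
  \<open>Digraph_Component.connected\<close> requires a vertex, so the graph without vertices would fall under
  the disconnected case and satisfy it vacuously; it is excluded explicitly.
\<close>

definition hoffman_colorable :: "('a, 'b) pre_digraph \<Rightarrow> bool" where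
  "hoffman_colorable G \<longleftrightarrow> verts G \<noteq> {} \<and>
     (if Digraph_Component.connected G then connected_hoffman_colorable G
      else (\<forall>H\<in>pre_digraph.sccs G. connected_hoffman_colorable H) \<and>
           (\<forall>H\<in>pre_digraph.sccs G. \<forall>K\<in>pre_digraph.sccs G.
              max_graph_eigenvalue H = max_graph_eigenvalue K \<and>
              min_graph_eigenvalue H = min_graph_eigenvalue K \<and>
              chromatic_number H = chromatic_number K))"

definition hoffman_colorable_with :: "('a, 'b) pre_digraph \<Rightarrow> nat \<Rightarrow> bool" where
  "hoffman_colorable_with G k \<longleftrightarrow> hoffman_colorable G \<and> chromatic_number G = k"

text \<open>
  \<open>override_on x y A\<close> agrees with \<open>y\<close> on \<open>A\<close> and with \<open>x\<close> elsewhere, so \<open>override_on x y V\<^sub>0\<close>,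
  read on \<open>V\<^sub>0 \<union> B\<close> with \<open>B\<close> disjoint from \<open>V\<^sub>0\<close>, is the function \<open>x|\<^sub>B \<squnion> y\<close>.
\<close>

end

theory Submission
  imports Defs "HOL-Analysis.Function_Topology"
begin

text \<open>
  Let \<open>A\<close> be the adjacency matrix of a graph with a \<open>k\<close>-coloring, \<open>x\<close> an eigenvector for \<open>\<theta>\<close>, and
  \<open>x\<^sub>i\<close> the part of \<open>x\<close> on color \<open>i\<close>. If \<open>A + \<nu>I\<close> is positive semidefinite, evaluating its form at
  the vectors \<open>x - k x\<^sub>i\<close> and summing over \<open>i\<close> gives \<open>\<theta> \<le> (k - 1) \<nu>\<close>; in the case of equality all
  \<open>x - k x\<^sub>i\<close> lie in the kernel, so \<open>A x\<^sub>i = \<nu> (x - x\<^sub>i)\<close>. Applied to \<open>T\<close>, and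
  with the symmetry of the spectrum of the bipartite graphs \<open>H\<^sub>i\<close>, this yields the same identity
  \<open>A w\<^sub>i = \<nu> (w - w\<^sub>i)\<close> on \<open>G\<close> for \<open>w = x \<squnion> y\<close>. Hence \<open>w\<close> is an eigenvector
  for \<open>c\<nu>\<close>, and the \<open>w\<^sub>i\<close> span an invariant subspace on which the only other eigenvalue is \<open>-\<nu>\<close>, so
  that eigenvectors for eigenvalues below \<open>-\<nu>\<close> are orthogonal to it. The identity passes to
  components, and since a positive eigenvector belongs to the largest eigenvalue, Hoffman
  colorability only depends on whether \<open>-\<nu>\<close> is the smallest one.
\<close>

section \<open>Symmetric matrices on a finite index set\<close>

text \<open>Vectors and matrices are total functions read on an index set \<open>S\<close>, so the
  same vector can be used on a graph and on its induced subgraphs.\<close>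

definition inner_on :: "'a set \<Rightarrow> ('a \<Rightarrow> real) \<Rightarrow> ('a \<Rightarrow> real) \<Rightarrow> real" where
  "inner_on S f g = (\<Sum>v\<in>S. f v * g v)"

definition apply_on :: "'a set \<Rightarrow> ('a \<Rightarrow> 'a \<Rightarrow> real) \<Rightarrow> ('a \<Rightarrow> real) \<Rightarrow> 'a \<Rightarrow> real" where
  "apply_on S A f u = (\<Sum>v\<in>S. A u v * f v)"

lemma inner_on_commute: "inner_on S f g = inner_on S g f"
  by (simp add: inner_on_def mult.commute)

text \<open>Differences \<open>f - t * g\<close> are the shape in which linear combinations are
  expanded below, so linearity is stated for them.\<close>

lemma inner_on_diff_scale_left:
  "inner_on S (\<lambda>v. f v - t * g v) h = inner_on S f h - t * inner_on S g h"
  by (simp add: inner_on_def left_diff_distrib sum_subtractf sum_distrib_left mult.assoc)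

lemma inner_on_diff_scale_right:
  "inner_on S h (\<lambda>v. f v - t * g v) = inner_on S h f - t * inner_on S h g"
  by (simp add: inner_on_commute[of S h] inner_on_diff_scale_left)

lemma inner_on_cong:
  "(\<And>v. v \<in> S \<Longrightarrow> f v = f' v) \<Longrightarrow> (\<And>v. v \<in> S \<Longrightarrow> g v = g' v) \<Longrightarrow> inner_on S f g = inner_on S f' g'"
  by (simp add: inner_on_def)

lemma inner_on_scale_right:
  "inner_on S f (\<lambda>v. t * g v) = t * inner_on S f g"
  by (simp add: inner_on_def sum_distrib_left algebra_simps)

lemma inner_on_self_nonneg: "0 \<le> inner_on S f f"
  by (simp add: inner_on_def sum_nonneg)

lemma inner_on_self_eq_0_iff: "finite S \<Longrightarrow> inner_on S f f = 0 \<longleftrightarrow> (\<forall>v\<in>S. f v = 0)"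
  by (simp add: inner_on_def sum_nonneg_eq_0_iff)

lemma apply_on_diff_scale:
  "apply_on S A (\<lambda>v. f v - t * g v) = (\<lambda>u. apply_on S A f u - t * apply_on S A g u)"
  by (rule ext) (simp add: apply_on_def right_diff_distrib sum_subtractf sum_distrib_left algebra_simps)

lemma inner_on_apply_on_swap:
  assumes "\<And>u v. u \<in> S \<Longrightarrow> v \<in> S \<Longrightarrow> A u v = A v u"
  shows "inner_on S f (apply_on S A g) = inner_on S (apply_on S A f) g"
proof -
  have "inner_on S f (apply_on S A g) = (\<Sum>u\<in>S. \<Sum>v\<in>S. A u v * f u * g v)"
    by (simp add: inner_on_def apply_on_def sum_distrib_left algebra_simps)
  also have "\<dots> = (\<Sum>v\<in>S. \<Sum>u\<in>S. A u v * f u * g v)"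
    by (rule sum.swap)
  also have "\<dots> = (\<Sum>v\<in>S. \<Sum>u\<in>S. A v u * f u * g v)"
    using assms by (intro sum.cong refl) simp
  also have "\<dots> = inner_on S (apply_on S A f) g"
    by (simp add: inner_on_def apply_on_def sum_distrib_right)
  finally show ?thesis .
qed

section \<open>Quadratic forms and the least eigenvalue\<close>

definition eigen_on :: "'a set \<Rightarrow> ('a \<Rightarrow> 'a \<Rightarrow> real) \<Rightarrow> real \<Rightarrow> ('a \<Rightarrow> real) \<Rightarrow> bool" where
  "eigen_on S A \<theta> f \<longleftrightarrow> (\<forall>u\<in>S. apply_on S A f u = \<theta> * f u)"

text \<open>For symmetric \<open>A\<close> this says that \<open>A - \<mu>I\<close> is positive
  semidefinite on \<open>S\<close>.\<close>

definition rayleigh_bound :: "'a set \<Rightarrow> ('a \<Rightarrow> 'a \<Rightarrow> real) \<Rightarrow> real \<Rightarrow> bool" where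
  "rayleigh_bound S A \<mu> \<longleftrightarrow> (\<forall>f. \<mu> * inner_on S f f \<le> inner_on S f (apply_on S A f))"

text \<open>The first variation: moving from a minimiser \<open>f\<close> of the form along \<open>A f - \<mu> f\<close> would
  decrease it.\<close>

lemma eigen_on_if_rayleigh_eq:
  assumes fin: "finite S" and sym: "\<And>u v. u \<in> S \<Longrightarrow> v \<in> S \<Longrightarrow> A u v = A v u"
    and psd: "rayleigh_bound S A \<mu>"
    and eq: "inner_on S f (apply_on S A f) = \<mu> * inner_on S f f"
  shows "eigen_on S A \<mu> f"
proof -
  define h where "h = (\<lambda>v. apply_on S A f v - \<mu> * f v)"
  define a where "a = inner_on S h h"
  define b where "b = inner_on S h (apply_on S A h) - \<mu> * inner_on S h h"
  have b: "b \<ge> 0"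
    using psd by (simp add: b_def rayleigh_bound_def)
  have a: "a = inner_on S h (apply_on S A f) - \<mu> * inner_on S h f"
    by (subst (2) h_def) (simp add: a_def inner_on_diff_scale_right h_def)
  \<comment> \<open>This is the form of \<open>A - \<mu>I\<close> at \<open>f - t * h\<close>: the
    constant term vanishes by \<open>eq\<close>, and both mixed terms equal
    \<open>a\<close>.\<close>
  have *: "0 \<le> - 2 * t * a + t\<^sup>2 * b" for t
  proof -
    have "\<mu> * inner_on S (\<lambda>v. f v - t * h v) (\<lambda>v. f v - t * h v)
        \<le> inner_on S (\<lambda>v. f v - t * h v) (apply_on S A (\<lambda>v. f v - t * h v))"
      using psd by (simp add: rayleigh_bound_def)
    moreover have "inner_on S f (apply_on S A h) = inner_on S h (apply_on S A f)"
      using inner_on_apply_on_swap[of S A f h] sym by (simp add: inner_on_commute)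
    ultimately show ?thesis
      using eq inner_on_commute[of S f h]
      by (simp add: apply_on_diff_scale inner_on_diff_scale_left inner_on_diff_scale_right
          a b_def power2_eq_square algebra_simps)
  qed
  have "a = 0"
  proof (rule ccontr)
    assume "a \<noteq> 0"
    then have "a > 0"
      using inner_on_self_nonneg[of S h] by (simp add: a_def)
    \<comment> \<open>The step length \<open>t = a / (b + 1)\<close> makes the linear term win; the
      summand 1 avoids division by zero when \<open>b = 0\<close>.\<close>
    have "- 2 * (a / c) * a + (a / c)\<^sup>2 * (c - 1) = a\<^sup>2 / c\<^sup>2 * (- c - 1)" if "c \<noteq> 0" for c
      using that by (simp add: field_simps power2_eq_square)
    from this[of "b + 1"]
    have "- 2 * (a / (b + 1)) * a + (a / (b + 1))\<^sup>2 * b = a\<^sup>2 / (b + 1)\<^sup>2 * (- b - 2)"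
      using b by simp
    moreover have "\<dots> < 0"
      using b \<open>a > 0\<close> by (intro mult_pos_neg) auto
    ultimately show False
      using *[of "a / (b + 1)"] by linarith
  qed
  then show ?thesis
    using fin by (simp add: a_def inner_on_self_eq_0_iff h_def eigen_on_def)
qed

text \<open>By compactness the form attains its minimum on the unit sphere. Homogeneity extends the
  bound to all vectors, and the first variation turns the minimiser into an eigenvector.\<close>

lemma exists_rayleigh_minimiser:
  assumes fin: "finite S" and ne: "S \<noteq> {}"
    and sym: "\<And>u v. u \<in> S \<Longrightarrow> v \<in> S \<Longrightarrow> A u v = A v u"
  obtains \<mu> f where "\<exists>v\<in>S. f v \<noteq> 0" "eigen_on S A \<mu> f" "rayleigh_bound S A \<mu>"
proof -
  define q where "q = (\<lambda>f. inner_on S f (apply_on S A f))"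
  \<comment> \<open>Coordinates outside \<open>S\<close> are pinned to 0, so this product over the
    whole type is compact and still contains every unit vector supported on
    \<open>S\<close>.\<close>
  define K where "K = PiE UNIV (\<lambda>v. if v \<in> S then {-1..1::real} else {0})"
  define K1 where "K1 = K \<inter> {f. inner_on S f f = 1}"
  have "compactin (product_topology (\<lambda>_. euclidean) UNIV) K"
    unfolding K_def by (subst compactin_PiE) auto
  then have "compact K"
    by (simp add: euclidean_product_topology)
  moreover have "closed {f :: 'a \<Rightarrow> real. inner_on S f f = 1}"
    unfolding inner_on_def by (intro closed_Collect_eq continuous_intros) auto
  ultimately have "compact K1"
    unfolding K1_def by (rule compact_Int_closed)
  moreover have "continuous_on K1 q"
    unfolding q_def inner_on_def apply_on_def
    by (rule continuous_on_subset[OF _ subset_UNIV])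
      (intro continuous_intros continuous_on_product_coordinates)
  moreover have "K1 \<noteq> {}"
  proof -
    obtain s where s: "s \<in> S" using ne by auto
    have "(\<lambda>v. if v = s then 1 else 0) \<in> K1"
      using s fin by (auto simp: K1_def K_def inner_on_def if_distrib cong: if_cong)
    then show ?thesis by auto
  qed
  ultimately obtain f where f: "f \<in> K1" "\<And>g. g \<in> K1 \<Longrightarrow> q f \<le> q g"
    using continuous_attains_inf[of K1 q] by blast
  have ray: "rayleigh_bound S A (q f)"
    unfolding rayleigh_bound_def
  proof
    fix g
    define n where "n = sqrt (inner_on S g g)"
    have n2: "inner_on S g g = n * n"
      using inner_on_self_nonneg[of S g] by (simp add: n_def)
    show "q f * inner_on S g g \<le> inner_on S g (apply_on S A g)"
    proof (cases "n = 0")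
      case True
      then have "\<forall>v\<in>S. g v = 0"
        using n2 fin by (simp add: inner_on_self_eq_0_iff)
      then show ?thesis
        using n2 True by (simp add: inner_on_def)
    next
      case False
      then have "n > 0"
        using inner_on_self_nonneg[of S g] by (simp add: n_def)
      define g' where "g' = (\<lambda>v. if v \<in> S then g v / n else 0)"
      have "\<bar>g v\<bar> \<le> n" if "v \<in> S" for v
      proof -
        have "(g v)\<^sup>2 \<le> inner_on S g g"
          unfolding inner_on_def power2_eq_square
          using that fin by (intro member_le_sum) auto
        then show ?thesis
          using n2 \<open>n > 0\<close> by (metis abs_le_square_iff abs_of_pos power2_eq_square)
      qed
      then have "- n \<le> g v \<and> g v \<le> n" if "v \<in> S" for v
        using that by (metis abs_le_D1 abs_le_D2 minus_le_iff)
      then have "g' \<in> K"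
        using \<open>n > 0\<close> by (auto simp: K_def g'_def field_simps)
      moreover have "inner_on S g' g' = inner_on S g g / (n * n)"
        by (simp add: inner_on_def g'_def sum_divide_distrib)
      ultimately have "g' \<in> K1"
        using n2 \<open>n > 0\<close> by (simp add: K1_def)
      then have "q f \<le> q g'"
        by (rule f)
      also have "q g' = inner_on S g (apply_on S A g) / (n * n)"
        by (simp add: q_def inner_on_def apply_on_def g'_def sum_divide_distrib sum_distrib_left)
      finally show ?thesis
        using \<open>n > 0\<close> n2 by (simp add: field_simps)
    qed
  qed
  have f1: "inner_on S f f = 1"
    using f by (simp add: K1_def)
  then have "\<exists>v\<in>S. f v \<noteq> 0"
    by (metis fin inner_on_self_eq_0_iff zero_neq_one)
  moreover have "eigen_on S A (q f) f"
    using fin sym ray by (rule eigen_on_if_rayleigh_eq) (simp_all add: f1 q_def)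
  ultimately show thesis
    using ray that by blast
qed

section \<open>Orthogonality of eigenvectors and the size of orthogonal families\<close>

lemma eigen_on_orthogonal:
  assumes sym: "\<And>u v. u \<in> S \<Longrightarrow> v \<in> S \<Longrightarrow> A u v = A v u"
    and "eigen_on S A \<theta> f" "eigen_on S A \<eta> g" "\<theta> \<noteq> \<eta>"
  shows "inner_on S f g = 0"
proof -
  have "inner_on S f (apply_on S A g) = inner_on S f (\<lambda>v. \<eta> * g v)"
    using assms by (intro inner_on_cong) (auto simp: eigen_on_def)
  moreover have "inner_on S (apply_on S A f) g = inner_on S (\<lambda>v. \<theta> * f v) g"
    using assms by (intro inner_on_cong) (auto simp: eigen_on_def)
  ultimately have "\<eta> * inner_on S f g = \<theta> * inner_on S f g"
    using inner_on_apply_on_swap[of S A f g] sym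
    by (simp add: inner_on_scale_right inner_on_commute[of S _ g])
  then show ?thesis
    using \<open>\<theta> \<noteq> \<eta>\<close> by simp
qed

text \<open>Bessel's inequality for the unit vectors of \<open>S\<close>, summed over \<open>S\<close>.\<close>

lemma card_orthogonal_family_le:
  assumes fin: "finite S" "finite F"
    and orth: "\<And>i j. i \<in> F \<Longrightarrow> j \<in> F \<Longrightarrow> i \<noteq> j \<Longrightarrow> inner_on S (e i) (e j) = 0"
    and nz: "\<And>i. i \<in> F \<Longrightarrow> \<exists>v\<in>S. e i v \<noteq> 0"
  shows "card F \<le> card S"
proof -
  define N where "N i = inner_on S (e i) (e i)" for i
  have N: "N i > 0" if "i \<in> F" for i
    using nz[OF that] inner_on_self_eq_0_iff[OF fin(1), of "e i"] inner_on_self_nonneg[of S "e i"]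
    by (auto simp: N_def less_le)
  have bessel: "(\<Sum>i\<in>F. (e i s)\<^sup>2 / N i) \<le> 1" if s: "s \<in> S" for s
  proof -
    \<comment> \<open>The orthogonal projection of the unit vector at \<open>s\<close> onto the span
      of the family. Its entry at \<open>s\<close> equals its squared norm, which forces
      \<open>p s \<le> 1\<close>.\<close>
    define p where "p v = (\<Sum>i\<in>F. e i s / N i * e i v)" for v
    have "inner_on S p p = (\<Sum>v\<in>S. \<Sum>i\<in>F. \<Sum>j\<in>F. e i s / N i * (e j s / N j) * (e i v * e j v))"
      unfolding inner_on_def p_def sum_product by (intro sum.cong refl) (simp add: algebra_simps)
    also have "\<dots> = (\<Sum>i\<in>F. \<Sum>j\<in>F. \<Sum>v\<in>S. e i s / N i * (e j s / N j) * (e i v * e j v))"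
      by (subst sum.swap, rule sum.cong[OF refl], rule sum.swap)
    also have "\<dots> = (\<Sum>i\<in>F. \<Sum>j\<in>F. e i s / N i * (e j s / N j) * inner_on S (e i) (e j))"
      by (simp add: inner_on_def sum_distrib_left)
    also have "\<dots> = (\<Sum>i\<in>F. \<Sum>j\<in>F. if i = j then e i s / N i * (e i s / N i) * N i else 0)"
      using orth by (intro sum.cong refl) (auto simp: N_def)
    also have "\<dots> = (\<Sum>i\<in>F. (e i s)\<^sup>2 / N i)"
      using fin N by (intro sum.cong refl) (force simp: power2_eq_square)
    finally have pp: "inner_on S p p = (\<Sum>i\<in>F. (e i s)\<^sup>2 / N i)" .
    have ps: "p s = (\<Sum>i\<in>F. (e i s)\<^sup>2 / N i)"
      unfolding p_def by (intro sum.cong refl) (simp add: power2_eq_square)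
    have "(p s)\<^sup>2 \<le> inner_on S p p"
      unfolding inner_on_def power2_eq_square using s fin by (intro member_le_sum) auto
    then have "p s * p s \<le> p s"
      using pp ps by (simp add: power2_eq_square)
    then have "p s \<le> 1"
      using mult_strict_right_mono[of 1 "p s" "p s"] by (cases "p s > 1") auto
    then show ?thesis
      by (simp add: ps)
  qed
  have "real (card F) = (\<Sum>i\<in>F. \<Sum>s\<in>S. (e i s)\<^sup>2 / N i)"
  proof -
    have "(\<Sum>s\<in>S. (e i s)\<^sup>2 / N i) = 1" if "i \<in> F" for i
      using N[OF that] by (simp add: N_def inner_on_def power2_eq_square flip: sum_divide_distrib)
    then show ?thesis by simp
  qed
  also have "\<dots> = (\<Sum>s\<in>S. \<Sum>i\<in>F. (e i s)\<^sup>2 / N i)"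
    by (rule sum.swap)
  also have "\<dots> \<le> (\<Sum>s\<in>S. 1)"
    by (intro sum_mono bessel)
  finally show ?thesis by simp
qed

text \<open>The triangle inequality gives
  \<open>\<bar>\<mu>\<bar> * \<bar>f\<bar> \<le> A \<bar>f\<bar>\<close> entrywise. Pairing with
  \<open>x\<close> and moving \<open>A\<close> over to \<open>x\<close> leaves a positive factor to
  cancel.\<close>

lemma perron_bound:
  assumes fin: "finite S" and sym: "\<And>u v. u \<in> S \<Longrightarrow> v \<in> S \<Longrightarrow> A u v = A v u"
    and nonneg: "\<And>u v. A u v \<ge> 0"
    and x: "eigen_on S A \<theta> x" "\<And>v. v \<in> S \<Longrightarrow> x v > 0"
    and f: "eigen_on S A \<mu> f" "\<exists>v\<in>S. f v \<noteq> 0"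
  shows "\<bar>\<mu>\<bar> \<le> \<theta>"
proof -
  define g where "g v = \<bar>f v\<bar>" for v
  have "\<bar>\<mu>\<bar> * g u \<le> apply_on S A g u" if "u \<in> S" for u
  proof -
    have "\<bar>\<mu>\<bar> * g u = \<bar>apply_on S A f u\<bar>"
      using f that by (simp add: eigen_on_def g_def abs_mult)
    also have "\<dots> \<le> apply_on S A g u"
      unfolding apply_on_def g_def
      using nonneg by (intro order.trans[OF sum_abs] sum_mono) (simp add: abs_mult)
    finally show ?thesis .
  qed
  then have "inner_on S x (\<lambda>u. \<bar>\<mu>\<bar> * g u) \<le> inner_on S x (apply_on S A g)"
    unfolding inner_on_def using x by (intro sum_mono mult_left_mono) (auto simp: less_imp_le)
  also have "\<dots> = inner_on S (\<lambda>u. \<theta> * x u) g"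
    using x by (subst inner_on_apply_on_swap) (auto simp: sym eigen_on_def intro: inner_on_cong)
  also have "\<dots> = \<theta> * inner_on S x g"
    by (simp add: inner_on_commute[of S _ g] inner_on_scale_right)
  finally have "\<bar>\<mu>\<bar> * inner_on S x g \<le> \<theta> * inner_on S x g"
    by (simp add: inner_on_scale_right)
  moreover obtain s where s: "s \<in> S" "f s \<noteq> 0" using f by auto
  have "inner_on S x g > 0"
    unfolding inner_on_def
    using fin s x by (intro sum_pos2[of S s]) (auto simp: g_def less_imp_le)
  ultimately show ?thesis by simp
qed

section \<open>Hoffman's bound and its case of equality\<close>

definition restrict_to_color :: "('a \<Rightarrow> nat) \<Rightarrow> ('a \<Rightarrow> real) \<Rightarrow> nat \<Rightarrow> 'a \<Rightarrow> real" where
  "restrict_to_color col x i v = (if col v = i then x v else 0)"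

text \<open>Color classes are independent, so the form of \<open>A\<close> vanishes at each part of
  \<open>x\<close>, and each summand depends only on the squared norms of \<open>x\<close> and of
  its part. The latter add up to the former. \<open>I\<close> may be any finite set containing the
  colors that occur.\<close>

lemma hoffman_identity:
  fixes col :: "'a \<Rightarrow> nat"
  assumes fin: "finite S" and sym: "\<And>u v. u \<in> S \<Longrightarrow> v \<in> S \<Longrightarrow> A u v = A v u"
    and proper: "\<And>u v. u \<in> S \<Longrightarrow> v \<in> S \<Longrightarrow> col u = col v \<Longrightarrow> A u v = 0"
    and I: "finite I" "col ` S \<subseteq> I"
    and x: "eigen_on S A \<theta> x"
  defines "w \<equiv> \<lambda>i v. x v - real (card I) * restrict_to_color col x i v"
  shows "(\<Sum>i\<in>I. inner_on S (w i) (apply_on S A (w i)) + \<nu> * inner_on S (w i) (w i))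
       = real (card I) * inner_on S x x * ((real (card I) - 1) * \<nu> - \<theta>)"
proof -
  define k where "k = real (card I)"
  define N where "N = inner_on S x x"
  define r where "r = restrict_to_color col x"
  define n where "n i = inner_on S (r i) (r i)" for i
  have nx: "inner_on S x (r i) = n i" for i
    unfolding n_def r_def inner_on_def by (intro sum.cong refl) (auto simp: restrict_to_color_def)
  have Ax: "inner_on S f (apply_on S A x) = \<theta> * inner_on S f x" for f
    using x unfolding inner_on_scale_right[symmetric] by (intro inner_on_cong) (auto simp: eigen_on_def)
  have Ar: "inner_on S x (apply_on S A (r i)) = \<theta> * n i" for i
    using Ax[of "r i"] nx[of i] by (subst inner_on_apply_on_swap) (auto simp: sym inner_on_commute)
  have rAr: "inner_on S (r i) (apply_on S A (r i)) = 0" for i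
    unfolding inner_on_def apply_on_def r_def sum_distrib_left
    by (intro sum.neutral ballI) (auto simp: restrict_to_color_def proper)
  have n_sum: "(\<Sum>i\<in>I. n i) = N"
  proof -
    have "(\<Sum>i\<in>I. n i) = (\<Sum>i\<in>I. \<Sum>v\<in>S. if col v = i then x v * x v else 0)"
      unfolding n_def inner_on_def r_def
      by (intro sum.cong refl) (auto simp: restrict_to_color_def)
    also have "\<dots> = (\<Sum>v\<in>S. \<Sum>i\<in>I. if col v = i then x v * x v else 0)"
      by (rule sum.swap)
    also have "\<dots> = N"
      unfolding N_def inner_on_def using I by (intro sum.cong refl) auto
    finally show ?thesis .
  qed
  have "inner_on S (w i) (apply_on S A (w i)) + \<nu> * inner_on S (w i) (w i)
      = (\<theta> + \<nu>) * N + (k\<^sup>2 * \<nu> - 2 * k * (\<theta> + \<nu>)) * n i" for i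
  proof -
    have w: "w i = (\<lambda>v. x v - k * r i v)"
      by (simp add: w_def k_def r_def)
    show ?thesis
      unfolding w apply_on_diff_scale inner_on_diff_scale_left inner_on_diff_scale_right
      using nx[of i]
      by (simp add: Ax Ar rAr inner_on_commute[of S "r i" x] flip: N_def n_def)
        (simp add: algebra_simps power2_eq_square)
  qed
  then have "(\<Sum>i\<in>I. inner_on S (w i) (apply_on S A (w i)) + \<nu> * inner_on S (w i) (w i))
      = k * (\<theta> + \<nu>) * N + (k\<^sup>2 * \<nu> - 2 * k * (\<theta> + \<nu>)) * N"
    by (simp add: sum.distrib n_sum k_def flip: sum_distrib_left)
  also have "\<dots> = k * N * ((k - 1) * \<nu> - \<theta>)"
    by (simp add: algebra_simps power2_eq_square)
  finally show ?thesis by (simp add: k_def N_def)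
qed

text \<open>With \<open>- \<nu>\<close> the least eigenvalue and \<open>I\<close> the colors of an
  optimal coloring this is Hoffman's bound, free of division.\<close>

lemma hoffman_inequality:
  fixes col :: "'a \<Rightarrow> nat"
  assumes fin: "finite S" and sym: "\<And>u v. u \<in> S \<Longrightarrow> v \<in> S \<Longrightarrow> A u v = A v u"
    and proper: "\<And>u v. u \<in> S \<Longrightarrow> v \<in> S \<Longrightarrow> col u = col v \<Longrightarrow> A u v = 0"
    and I: "finite I" "col ` S \<subseteq> I"
    and x: "eigen_on S A \<theta> x" "\<exists>v\<in>S. x v \<noteq> 0"
    and psd: "rayleigh_bound S A (- \<nu>)"
  shows "\<theta> \<le> (real (card I) - 1) * \<nu>"
proof -
  define w where "w i v = x v - real (card I) * restrict_to_color col x i v" for i v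
  have "0 \<le> (\<Sum>i\<in>I. inner_on S (w i) (apply_on S A (w i)) + \<nu> * inner_on S (w i) (w i))"
    using psd by (intro sum_nonneg) (simp add: rayleigh_bound_def, smt (verit, best))
  also have "\<dots> = real (card I) * inner_on S x x * ((real (card I) - 1) * \<nu> - \<theta>)"
    unfolding w_def using fin sym proper I x(1) by (rule hoffman_identity)
  finally have "0 \<le> real (card I) * inner_on S x x * ((real (card I) - 1) * \<nu> - \<theta>)" .
  moreover have "inner_on S x x > 0"
    using x(2) fin by (metis inner_on_self_eq_0_iff inner_on_self_nonneg less_le)
  moreover have "card I > 0"
    using I x(2) by (auto simp: card_gt_0_iff)
  ultimately show ?thesis
    by (smt (verit, best) mult_pos_neg mult_pos_pos of_nat_0_less_iff)
qed

text \<open>A vanishing sum of nonnegative terms makes every \<open>w i\<close> minimise the form,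
  hence \<open>A w_i = - \<nu> w_i\<close>. Subtracting this from the eigenvalue equation of
  \<open>x\<close> isolates the image of a single part.\<close>

lemma hoffman_equality:
  fixes col :: "'a \<Rightarrow> nat"
  assumes fin: "finite S" and sym: "\<And>u v. u \<in> S \<Longrightarrow> v \<in> S \<Longrightarrow> A u v = A v u"
    and proper: "\<And>u v. u \<in> S \<Longrightarrow> v \<in> S \<Longrightarrow> col u = col v \<Longrightarrow> A u v = 0"
    and I: "finite I" "col ` S \<subseteq> I" "i \<in> I"
    and x: "eigen_on S A ((real (card I) - 1) * \<nu>) x"
    and psd: "rayleigh_bound S A (- \<nu>)"
    and u: "u \<in> S"
  shows "apply_on S A (restrict_to_color col x i) u = (if col u = i then 0 else \<nu> * x u)"
proof -
  define k where "k = real (card I)"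
  define w where "w i v = x v - k * restrict_to_color col x i v" for i v
  have nonneg: "0 \<le> inner_on S (w j) (apply_on S A (w j)) + \<nu> * inner_on S (w j) (w j)" for j
    using psd unfolding rayleigh_bound_def by (smt (verit, best) mult_minus_left)
  have "(\<Sum>j\<in>I. inner_on S (w j) (apply_on S A (w j)) + \<nu> * inner_on S (w j) (w j)) = 0"
    unfolding w_def k_def
    by (subst hoffman_identity[OF fin sym proper I(1,2) x]) simp_all
  then have "inner_on S (w i) (apply_on S A (w i)) + \<nu> * inner_on S (w i) (w i) = 0"
    using nonneg I by (simp add: sum_nonneg_eq_0_iff)
  then have "inner_on S (w i) (apply_on S A (w i)) = - \<nu> * inner_on S (w i) (w i)"
    by simp
  \<comment> \<open>\<open>eigen_on\<close> admits the zero vector, so \<open>w i\<close> is allowed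
    to vanish here.\<close>
  then have "eigen_on S A (- \<nu>) (w i)"
    using eigen_on_if_rayleigh_eq[OF fin sym psd] by blast
  then have "apply_on S A x u - k * apply_on S A (restrict_to_color col x i) u = - \<nu> * w i u"
    using u by (simp add: eigen_on_def w_def[abs_def] apply_on_diff_scale)
  then have "k * apply_on S A (restrict_to_color col x i) u
      = k * (\<nu> * x u - \<nu> * restrict_to_color col x i u)"
    using x u by (simp add: eigen_on_def w_def algebra_simps flip: k_def)
  moreover have "k \<noteq> 0"
    using I by (auto simp: k_def card_gt_0_iff)
  ultimately show ?thesis
    by (simp add: restrict_to_color_def)
qed

section \<open>Eigenvalues of graphs and of their components\<close>

lemma graph_eigenvector_iff_eigen_on:
  "graph_eigenvector G \<theta> f \<longleftrightarrow>
     (\<exists>v\<in>verts G. f v \<noteq> 0) \<and> eigen_on (verts G) (adjacency_matrix G) \<theta> f"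
  by (simp add: graph_eigenvector_def eigen_on_def apply_on_def)

lemma adjacency_matrix_nonneg: "adjacency_matrix G u v \<ge> 0"
  by (simp add: adjacency_matrix_def)

lemma adjacency_matrix_induce_subgraph:
  "u \<in> W \<Longrightarrow> v \<in> W \<Longrightarrow> adjacency_matrix (G \<restriction> W) u v = adjacency_matrix G u v"
  by (auto simp: adjacency_matrix_def arcs_ends_def arc_to_ends_def)

lemma apply_on_adjacency_induce_subgraph:
  "u \<in> W \<Longrightarrow> apply_on W (adjacency_matrix (G \<restriction> W)) f u = apply_on W (adjacency_matrix G) f u"
  by (simp add: apply_on_def adjacency_matrix_induce_subgraph)

lemma proper_coloring_induce_subgraph:
  "proper_coloring G k col \<Longrightarrow> W \<subseteq> verts G \<Longrightarrow> proper_coloring (G \<restriction> W) k col"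
  by (auto simp: proper_coloring_def dest: dominates_induce_subgraphD)

lemma adjacency_matrix_proper_coloring:
  "proper_coloring G k col \<Longrightarrow> col u = col v \<Longrightarrow> adjacency_matrix G u v = 0"
  by (auto simp: proper_coloring_def adjacency_matrix_def)

lemma chromatic_number_le: "proper_coloring G k col \<Longrightarrow> chromatic_number G \<le> k"
  unfolding chromatic_number_def by (intro Least_le exI)

text \<open>Some coloring must be given for the \<open>LEAST\<close> in the chromatic number to be
  attained.\<close>

lemma proper_coloring_chromatic_number:
  assumes "proper_coloring G k col"
  obtains col' where "proper_coloring G (chromatic_number G) col'"
  using assms LeastI[of "\<lambda>k. \<exists>col. proper_coloring G k col" k]
  unfolding chromatic_number_def by blast

section \<open>The spectrum of a finite graph\<close>

context Digraph.graph
begin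

lemma adjacency_matrix_sym: "adjacency_matrix G u v = adjacency_matrix G v u"
  using graph_symmetric by (auto simp: adjacency_matrix_def)

lemma graph_induce_subgraph:
  assumes "W \<subseteq> verts G"
  shows "Digraph.graph (G \<restriction> W)"
proof -
  have "induced_subgraph (G \<restriction> W) G"
    using assms by auto
  then show ?thesis
    using digraph.graphI[OF digraphI_induced] induced_graph_imp_symmetric[OF sym_arcs] by blast
qed

text \<open>One eigenvector per eigenvalue yields an orthogonal family, so there are at most as many
  eigenvalues as vertices. This is what gives \<open>Min\<close> and \<open>Max\<close> their
  meaning.\<close>

lemma finite_graph_eigenvalues: "finite (graph_eigenvalues G)"
proof -
  have "card F \<le> card (verts G)" if F: "F \<subseteq> graph_eigenvalues G" "finite F" for F
  proof -
    have "\<forall>\<theta>\<in>F. \<exists>f. graph_eigenvector G \<theta> f"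
      using F by (auto simp: graph_eigenvalues_def)
    then obtain e where e: "\<And>\<theta>. \<theta> \<in> F \<Longrightarrow> graph_eigenvector G \<theta> (e \<theta>)"
      by metis
    show ?thesis
    proof (rule card_orthogonal_family_le[OF finite_verts F(2)])
      show "inner_on (verts G) (e i) (e j) = 0" if "i \<in> F" "j \<in> F" "i \<noteq> j" for i j
        using that e adjacency_matrix_sym
        by (intro eigen_on_orthogonal[of "verts G" "adjacency_matrix G" i _ j])
          (auto simp: graph_eigenvector_iff_eigen_on)
      show "\<exists>v\<in>verts G. e i v \<noteq> 0" if "i \<in> F" for i
        using e[OF that] by (simp add: graph_eigenvector_iff_eigen_on)
    qed
  qed
  then show ?thesis
    using finite_if_finite_subsets_card_bdd by blast
qed

lemma min_graph_eigenvalue_le: "graph_eigenvector G \<theta> f \<Longrightarrow> min_graph_eigenvalue G \<le> \<theta>"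
  unfolding min_graph_eigenvalue_def
  by (intro Min_le finite_graph_eigenvalues) (auto simp: graph_eigenvalues_def)

lemma min_graph_eigenvalue_eqI:
  assumes "graph_eigenvector G \<theta> f" "\<And>\<eta> g. graph_eigenvector G \<eta> g \<Longrightarrow> \<theta> \<le> \<eta>"
  shows "min_graph_eigenvalue G = \<theta>"
  unfolding min_graph_eigenvalue_def
  using assms by (intro Min_eqI finite_graph_eigenvalues) (auto simp: graph_eigenvalues_def)

text \<open>The minimum of the form is itself an eigenvalue, hence at least the \<open>Min\<close>,
  and a Rayleigh bound stays valid when lowered.\<close>

lemma rayleigh_bound_min_graph_eigenvalue:
  assumes "verts G \<noteq> {}"
  shows "rayleigh_bound (verts G) (adjacency_matrix G) (min_graph_eigenvalue G)"
proof -
  obtain \<mu> f where f: "\<exists>v\<in>verts G. f v \<noteq> 0" "eigen_on (verts G) (adjacency_matrix G) \<mu> f"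
    and ray: "rayleigh_bound (verts G) (adjacency_matrix G) \<mu>"
    using exists_rayleigh_minimiser[OF finite_verts assms, of "adjacency_matrix G"]
      adjacency_matrix_sym by metis
  then have "min_graph_eigenvalue G \<le> \<mu>"
    by (intro min_graph_eigenvalue_le) (simp add: graph_eigenvector_iff_eigen_on)
  then show ?thesis
    using ray unfolding rayleigh_bound_def
    by (meson inner_on_self_nonneg mult_right_mono order_trans)
qed

lemma min_graph_eigenvalue_attained:
  assumes "verts G \<noteq> {}"
  obtains f where "graph_eigenvector G (min_graph_eigenvalue G) f"
proof -
  obtain \<mu> f where "\<exists>v\<in>verts G. f v \<noteq> 0" "eigen_on (verts G) (adjacency_matrix G) \<mu> f"
    using exists_rayleigh_minimiser[OF finite_verts assms, of "adjacency_matrix G"]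
      adjacency_matrix_sym by metis
  then have "graph_eigenvalues G \<noteq> {}"
    by (auto simp: graph_eigenvalues_def graph_eigenvector_iff_eigen_on)
  then have "min_graph_eigenvalue G \<in> graph_eigenvalues G"
    unfolding min_graph_eigenvalue_def by (intro Min_in finite_graph_eigenvalues)
  then show thesis
    using that by (auto simp: graph_eigenvalues_def)
qed

lemma abs_eigenvalue_le_positive:
  assumes "positive_graph_eigenvector G \<theta> x" "graph_eigenvector G \<mu> f"
  shows "\<bar>\<mu>\<bar> \<le> \<theta>"
proof (rule perron_bound[OF finite_verts, where A = "adjacency_matrix G"])
  show "eigen_on (verts G) (adjacency_matrix G) \<theta> x" "\<And>v. v \<in> verts G \<Longrightarrow> x v > 0"
    "eigen_on (verts G) (adjacency_matrix G) \<mu> f" "\<exists>v\<in>verts G. f v \<noteq> 0"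
    using assms by (simp_all add: positive_graph_eigenvector_def graph_eigenvector_iff_eigen_on)
qed (rule adjacency_matrix_sym adjacency_matrix_nonneg)+

lemma max_graph_eigenvalue_positive:
  assumes "positive_graph_eigenvector G \<theta> x"
  shows "max_graph_eigenvalue G = \<theta>"
  unfolding max_graph_eigenvalue_def
proof (rule Max_eqI[OF finite_graph_eigenvalues])
  show "\<theta> \<in> graph_eigenvalues G"
    using assms by (auto simp: graph_eigenvalues_def positive_graph_eigenvector_def)
  show "\<mu> \<le> \<theta>" if "\<mu> \<in> graph_eigenvalues G" for \<mu>
    using that abs_eigenvalue_le_positive[OF assms] abs_ge_self order_trans
    by (fastforce simp: graph_eigenvalues_def)
qed

text \<open>If the adjacency matrix were positive semidefinite, its zero diagonal would force it to
  vanish.\<close>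

lemma min_graph_eigenvalue_neg:
  assumes "arcs G \<noteq> {}"
  shows "min_graph_eigenvalue G < 0"
proof (rule ccontr)
  assume neg: "\<not> min_graph_eigenvalue G < 0"
  obtain e where e: "e \<in> arcs G"
    using assms by auto
  define u where "u = tail G e"
  define v where "v = head G e"
  have uv: "u \<in> verts G" "v \<in> verts G" "adjacency_matrix G v u = 1"
    using e in_arcs_imp_in_arcs_ends[OF e] graph_symmetric
    by (auto simp: u_def v_def adjacency_matrix_def)
  \<comment> \<open>The unit vector at \<open>u\<close>. Without a loop the form is 0 at it, so it
    would lie in the kernel, yet its image has entry 1 at \<open>v\<close>.\<close>
  define d where "d = (\<lambda>w. if w = u then 1 else 0 :: real)"
  have Ad: "apply_on (verts G) (adjacency_matrix G) d w = adjacency_matrix G w u" for w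
    using uv by (simp add: apply_on_def d_def if_distrib cong: if_cong)
  have loop: "adjacency_matrix G u u = 0"
    using no_loops by (auto simp: adjacency_matrix_def arcs_ends_conv)
  have "inner_on (verts G) d (apply_on (verts G) (adjacency_matrix G) d) = 0"
    unfolding inner_on_def Ad by (intro sum.neutral) (auto simp: d_def loop)
  moreover have "rayleigh_bound (verts G) (adjacency_matrix G) 0"
    unfolding rayleigh_bound_def
  proof
    fix f
    have "0 \<le> min_graph_eigenvalue G * inner_on (verts G) f f"
      using neg inner_on_self_nonneg[of "verts G" f] by simp
    also have "\<dots> \<le> inner_on (verts G) f (apply_on (verts G) (adjacency_matrix G) f)"
      using rayleigh_bound_min_graph_eigenvalue uv by (auto simp: rayleigh_bound_def)
    finally show "0 * inner_on (verts G) f f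
        \<le> inner_on (verts G) f (apply_on (verts G) (adjacency_matrix G) f)"
      by simp
  qed
  ultimately have "eigen_on (verts G) (adjacency_matrix G) 0 d"
    by (intro eigen_on_if_rayleigh_eq[OF finite_verts]) (auto simp: adjacency_matrix_sym)
  then show False
    using uv Ad[of v] by (simp add: eigen_on_def)
qed

section \<open>Neighbor-closed vertex sets and connected components\<close>

lemma apply_on_closed:
  assumes "C \<subseteq> verts G" "\<And>u v. u \<in> C \<Longrightarrow> u \<rightarrow> v \<Longrightarrow> v \<in> C" "u \<in> C"
  shows "apply_on (verts G) (adjacency_matrix G) f u = apply_on C (adjacency_matrix (G \<restriction> C)) f u"
proof -
  have "apply_on (verts G) (adjacency_matrix G) f u = apply_on C (adjacency_matrix G) f u"
    unfolding apply_on_def using assms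
    by (intro sum.mono_neutral_right) (auto simp: adjacency_matrix_def)
  then show ?thesis
    using assms by (simp add: apply_on_adjacency_induce_subgraph)
qed

lemma graph_eigenvector_closed:
  assumes "C \<subseteq> verts G" "\<And>u v. u \<in> C \<Longrightarrow> u \<rightarrow> v \<Longrightarrow> v \<in> C"
    and "graph_eigenvector G \<theta> f" "\<exists>v\<in>C. f v \<noteq> 0"
  shows "graph_eigenvector (G \<restriction> C) \<theta> f"
proof -
  have "apply_on C (adjacency_matrix (G \<restriction> C)) f u = \<theta> * f u" if "u \<in> C" for u
    using apply_on_closed[OF assms(1) _ that, of f] assms(1-3) that
    by (auto simp: graph_eigenvector_iff_eigen_on eigen_on_def)
  then show ?thesis
    using assms by (auto simp: graph_eigenvector_iff_eigen_on eigen_on_def)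
qed

lemma graph_eigenvector_extend_closed:
  assumes "C \<subseteq> verts G" "\<And>u v. u \<in> C \<Longrightarrow> u \<rightarrow> v \<Longrightarrow> v \<in> C"
    and f: "graph_eigenvector (G \<restriction> C) \<theta> f"
  shows "graph_eigenvector G \<theta> (\<lambda>v. if v \<in> C then f v else 0)"
proof -
  let ?g = "\<lambda>v. if v \<in> C then f v else 0"
  have "apply_on (verts G) (adjacency_matrix G) ?g u = \<theta> * ?g u" if u: "u \<in> verts G" for u
  proof (cases "u \<in> C")
    case True
    have "apply_on (verts G) (adjacency_matrix G) ?g u = apply_on C (adjacency_matrix (G \<restriction> C)) ?g u"
      using assms(1,2) True by (rule apply_on_closed)
    also have "\<dots> = apply_on C (adjacency_matrix (G \<restriction> C)) f u"
      by (simp add: apply_on_def)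
    finally show ?thesis
      using f True by (simp add: graph_eigenvector_iff_eigen_on eigen_on_def)
  next
    case False
    \<comment> \<open>By symmetry an arc from \<open>u\<close> into \<open>C\<close> would bring
      \<open>u\<close> into \<open>C\<close>.\<close>
    have "adjacency_matrix G u v = 0" if "v \<in> C" for v
      using assms(2)[OF that, of u] False graph_symmetric[of u v]
      by (auto simp: adjacency_matrix_def)
    then have "apply_on (verts G) (adjacency_matrix G) ?g u = 0"
      unfolding apply_on_def by (intro sum.neutral) auto
    then show ?thesis
      using False by simp
  qed
  then show ?thesis
    using assms(1) f by (auto simp: graph_eigenvector_iff_eigen_on eigen_on_def)
qed

lemma sccs_subset_verts: "H \<in> sccs \<Longrightarrow> verts H \<subseteq> verts G"
  by (auto dest: in_sccs_imp_induced)

lemma induce_verts_scc: "H \<in> sccs \<Longrightarrow> G \<restriction> verts H = H"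
  by (intro induce_eq_iff_induced in_sccs_imp_induced)

text \<open>In a symmetric graph the two ends of an arc reach each other, so no arc leaves a
  strongly connected component.\<close>

lemma scc_closed:
  assumes "H \<in> sccs" "u \<in> verts H" "u \<rightarrow> v"
  shows "v \<in> verts H"
proof (rule ccontr)
  assume "v \<notin> verts H"
  moreover have "verts H \<in> sccs_verts"
    using assms(1) by (intro in_sccs_vertsI_sccs) auto
  ultimately have "\<not> u \<rightarrow>\<^sup>* v \<or> \<not> v \<rightarrow>\<^sup>* u"
    using assms(2) by (auto simp: sccs_verts_def)
  then show False
    using assms(3) graph_symmetric by auto
qed

lemma graph_scc:
  assumes "H \<in> sccs"
  shows "Digraph.graph H"
  using graph_induce_subgraph[OF sccs_subset_verts[OF assms]]
  by (simp add: induce_verts_scc[OF assms])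

lemma connected_scc:
  assumes "H \<in> sccs"
  shows "Digraph_Component.connected H"
proof -
  interpret H: Digraph.graph H
    using assms by (rule graph_scc)
  have "strongly_connected H"
    using assms by auto
  then show ?thesis
    by (intro H.connectedI) (auto simp: strongly_connected_def intro: H.reachable_mk_symmetricI)
qed

lemma ex_scc: "v \<in> verts G \<Longrightarrow> \<exists>H\<in>sccs. v \<in> verts H"
  using induce_reachable_is_in_sccs[of v]
  by (intro bexI[of _ "G \<restriction> {w. v \<rightarrow>\<^sup>* w}"]) auto

lemma graph_eigenvector_scc:
  assumes "H \<in> sccs" "graph_eigenvector G \<theta> f" "\<exists>v\<in>verts H. f v \<noteq> 0"
  shows "graph_eigenvector H \<theta> f"
  using graph_eigenvector_closed[OF sccs_subset_verts[OF assms(1)] scc_closed[OF assms(1)] assms(2,3)]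
  by (simp add: induce_verts_scc[OF assms(1)])

lemma positive_graph_eigenvector_scc:
  assumes "H \<in> sccs" "positive_graph_eigenvector G \<theta> f"
  shows "positive_graph_eigenvector H \<theta> f"
proof -
  have "verts H \<noteq> {}"
    using assms(1) by (auto simp: sccs_def strongly_connected_def)
  moreover have "\<forall>v\<in>verts H. f v > 0"
    using assms sccs_subset_verts by (auto simp: positive_graph_eigenvector_def)
  ultimately have "\<exists>v\<in>verts H. f v \<noteq> 0"
    by fastforce
  then show ?thesis
    using assms graph_eigenvector_scc \<open>\<forall>v\<in>verts H. f v > 0\<close>
    by (simp add: positive_graph_eigenvector_def)
qed

lemma graph_eigenvector_extend_scc:
  assumes "H \<in> sccs" "graph_eigenvector H \<theta> f"
  shows "graph_eigenvector G \<theta> (\<lambda>v. if v \<in> verts H then f v else 0)"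
  using graph_eigenvector_extend_closed[OF sccs_subset_verts[OF assms(1)] scc_closed[OF assms(1)]]
    assms(2) by (simp add: induce_verts_scc[OF assms(1)])

lemma min_graph_eigenvalue_scc_ge:
  assumes "H \<in> sccs"
  shows "min_graph_eigenvalue G \<le> min_graph_eigenvalue H"
proof -
  interpret H: Digraph.graph H
    using assms by (rule graph_scc)
  have "verts H \<noteq> {}"
    using assms by (auto simp: sccs_def strongly_connected_def)
  then obtain f where "graph_eigenvector H (min_graph_eigenvalue H) f"
    by (rule H.min_graph_eigenvalue_attained)
  then show ?thesis
    using min_graph_eigenvalue_le graph_eigenvector_extend_scc[OF assms] by blast
qed

text \<open>An eigenvector for the least eigenvalue is nonzero on some component and restricts to an
  eigenvector there; extension by zero gives the opposite inequality.\<close>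

lemma min_graph_eigenvalue_eq_scc:
  assumes "verts G \<noteq> {}"
  obtains H where "H \<in> sccs" "min_graph_eigenvalue G = min_graph_eigenvalue H"
proof -
  obtain f where f: "graph_eigenvector G (min_graph_eigenvalue G) f"
    using assms by (rule min_graph_eigenvalue_attained)
  then obtain v where v: "v \<in> verts G" "f v \<noteq> 0"
    by (auto simp: graph_eigenvector_def)
  then obtain H where H: "H \<in> sccs" "v \<in> verts H"
    using ex_scc by blast
  interpret H: Digraph.graph H
    using H(1) by (rule graph_scc)
  have "graph_eigenvector H (min_graph_eigenvalue G) f"
    using H f v by (blast intro: graph_eigenvector_scc[OF H(1)])
  then have "min_graph_eigenvalue H \<le> min_graph_eigenvalue G"
    by (rule H.min_graph_eigenvalue_le)
  then show thesis
    using min_graph_eigenvalue_scc_ge[OF H(1)] H(1) that by fastforce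
qed

lemma proper_coloring_scc:
  assumes "H \<in> sccs" "proper_coloring G k col"
  shows "proper_coloring H k col"
  using proper_coloring_induce_subgraph[OF assms(2) sccs_subset_verts[OF assms(1)]]
  by (simp add: induce_verts_scc[OF assms(1)])

text \<open>Every arc stays inside one component, so colorings chosen separately on the components
  never conflict.\<close>

lemma proper_coloring_glue_sccs:
  assumes "\<And>H. H \<in> sccs \<Longrightarrow> \<exists>col. proper_coloring H k col"
  obtains col where "proper_coloring G k col"
proof -
  obtain c where c: "\<And>H. H \<in> sccs \<Longrightarrow> proper_coloring H k (c H)"
    using assms by metis
  obtain K where K: "\<And>v. v \<in> verts G \<Longrightarrow> K v \<in> sccs \<and> v \<in> verts (K v)"
    using ex_scc by metis
  have "c (K u) u \<noteq> c (K v) v" if uv: "u \<rightarrow> v" for u v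
  proof -
    have verts: "u \<in> verts G" "v \<in> verts G"
      using uv by (auto simp: arcs_ends_conv)
    then have v: "v \<in> verts (K u)"
      using K scc_closed uv by blast
    then have "K u = K v"
      using K verts scc_disj by blast
    moreover have "u \<rightarrow>\<^bsub>K u\<^esub> v"
    proof -
      have "adjacency_matrix (G \<restriction> verts (K u)) u v = adjacency_matrix G u v"
        using K verts v by (intro adjacency_matrix_induce_subgraph) auto
      then show ?thesis
        using uv K verts by (simp add: induce_verts_scc adjacency_matrix_def split: if_splits)
    qed
    ultimately show ?thesis
      using c K verts by (metis proper_coloring_def)
  qed
  moreover have "c (K v) v < k" if "v \<in> verts G" for v
    using c K[OF that] by (auto simp: proper_coloring_def)
  ultimately have "proper_coloring G k (\<lambda>v. c (K v) v)"
    by (auto simp: proper_coloring_def)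
  then show thesis
    by (rule that)
qed

text \<open>Gluing gives the upper bound and the single component \<open>H\<close> the lower one;
  \<open>k'\<close> only witnesses that a coloring exists.\<close>

lemma chromatic_number_eq_if_sccs:
  assumes col: "proper_coloring G k' col" and "H \<in> sccs"
    and "\<And>K. K \<in> sccs \<Longrightarrow> chromatic_number K = k"
  shows "chromatic_number G = k"
proof (rule antisym)
  have "\<exists>col. proper_coloring K k col" if "K \<in> sccs" for K
    using proper_coloring_chromatic_number[OF proper_coloring_scc[OF that col]] assms(3)[OF that]
    by metis
  then obtain col' where "proper_coloring G k col'"
    using proper_coloring_glue_sccs by blast
  then show "chromatic_number G \<le> k"
    by (rule chromatic_number_le)
  obtain col' where "proper_coloring G (chromatic_number G) col'"
    using col by (rule proper_coloring_chromatic_number)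
  then have "chromatic_number H \<le> chromatic_number G"
    by (rule chromatic_number_le[OF proper_coloring_scc[OF \<open>H \<in> sccs\<close>]])
  then show "k \<le> chromatic_number G"
    using assms by simp
qed

section \<open>Positive eigenvectors of Hoffman colorable graphs\<close>

lemma connected_hoffman_colorable_eigenvalue:
  assumes "connected_hoffman_colorable G" "positive_graph_eigenvector G \<theta> x"
  shows "min_graph_eigenvalue G < 0"
    and "\<theta> = (real (chromatic_number G) - 1) * (- min_graph_eigenvalue G)"
proof -
  show neg: "min_graph_eigenvalue G < 0"
    using assms min_graph_eigenvalue_neg by (simp add: connected_hoffman_colorable_def)
  have "real (chromatic_number G) = 1 - \<theta> / min_graph_eigenvalue G"
    using assms max_graph_eigenvalue_positive
    by (simp add: connected_hoffman_colorable_def hoffman_bound_def)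
  then show "\<theta> = (real (chromatic_number G) - 1) * (- min_graph_eigenvalue G)"
    using neg by (simp add: field_simps)
qed

text \<open>A positive eigenvector restricts to one on each component with the same eigenvalue, so
  the disconnected case reduces to a component attaining the least eigenvalue.\<close>

lemma hoffman_colorable_eigenvalue:
  assumes hc: "hoffman_colorable G" and pos: "positive_graph_eigenvector G \<theta> x"
    and col: "proper_coloring G k col"
  shows "min_graph_eigenvalue G < 0"
    and "\<theta> = (real (chromatic_number G) - 1) * (- min_graph_eigenvalue G)"
proof -
  have "min_graph_eigenvalue G < 0
      \<and> \<theta> = (real (chromatic_number G) - 1) * (- min_graph_eigenvalue G)"
  proof (cases "Digraph_Component.connected G")
    case True
    then show ?thesis
      using hc connected_hoffman_colorable_eigenvalue[OF _ pos] by (simp add: hoffman_colorable_def)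
  next
    case False
    note hc' = hc[unfolded hoffman_colorable_def if_not_P[OF False]]
    have "verts G \<noteq> {}"
      using hc' by blast
    then obtain H where H: "H \<in> sccs" "min_graph_eigenvalue G = min_graph_eigenvalue H"
      by (rule min_graph_eigenvalue_eq_scc)
    have H_hc: "connected_hoffman_colorable H"
      using H(1) hc' by blast
    interpret H: Digraph.graph H
      using H(1) by (rule graph_scc)
    have "chromatic_number K = chromatic_number H" if "K \<in> sccs" for K
      using that H(1) hc' by blast
    then have "chromatic_number G = chromatic_number H"
      by (rule chromatic_number_eq_if_sccs[OF col H(1)])
    then show ?thesis
      using H(2) H.connected_hoffman_colorable_eigenvalue[OF H_hc
          positive_graph_eigenvector_scc[OF H(1) pos]]
      by simp
  qed
  then show "min_graph_eigenvalue G < 0"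
    "\<theta> = (real (chromatic_number G) - 1) * (- min_graph_eigenvalue G)"
    by blast+
qed

end

section \<open>Weight-regular colorings\<close>

text \<open>The identity \<open>A w_i = \<nu> (w - w_i)\<close> for all colors from 0 to
  \<open>c\<close>: each vertex \<open>u\<close> sees the same weight \<open>\<nu> * w u\<close> in
  every color other than its own.\<close>

definition weight_regular ::
  "('a, 'b) pre_digraph \<Rightarrow> nat \<Rightarrow> ('a \<Rightarrow> nat) \<Rightarrow> real \<Rightarrow> ('a \<Rightarrow> real) \<Rightarrow> bool" where
  "weight_regular G c col \<nu> w \<longleftrightarrow> (\<forall>u\<in>verts G. \<forall>i\<le>c.
     apply_on (verts G) (adjacency_matrix G) (restrict_to_color col w i) u =
     (if col u = i then 0 else \<nu> * w u))"

lemma sum_restrict_to_color: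
  "finite S \<Longrightarrow> (\<Sum>v\<in>S. f v * restrict_to_color col w i v) = (\<Sum>v\<in>{v\<in>S. col v = i}. f v * w v)"
  by (subst sum.inter_filter) (auto simp: restrict_to_color_def intro!: sum.cong)

lemma apply_on_restrict_to_color:
  "finite S \<Longrightarrow> apply_on S A (restrict_to_color col w i) u = (\<Sum>v\<in>{v\<in>S. col v = i}. A u v * w v)"
  by (simp add: apply_on_def sum_restrict_to_color)

lemma apply_on_sum_colors:
  assumes "finite I" "\<And>v. v \<in> S \<Longrightarrow> col v \<in> I"
  shows "apply_on S A w u = (\<Sum>i\<in>I. apply_on S A (restrict_to_color col w i) u)"
proof -
  have "w v = (\<Sum>i\<in>I. restrict_to_color col w i v)" if "v \<in> S" for v
    using assms that by (simp add: restrict_to_color_def)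
  then have "apply_on S A w u = (\<Sum>v\<in>S. \<Sum>i\<in>I. A u v * restrict_to_color col w i v)"
    by (simp add: apply_on_def flip: sum_distrib_left)
  then show ?thesis
    unfolding apply_on_def by (subst sum.swap)
qed

text \<open>A locale, because it is instantiated both for the whole graph and for each of its
  components with the same \<open>c\<close>, \<open>col\<close>, \<open>\<nu>\<close> and
  \<open>w\<close>.\<close>

locale weight_regular_graph = Digraph.graph G for G :: "('a, 'b) pre_digraph" (structure) +
  fixes c :: nat and col :: "'a \<Rightarrow> nat" and \<nu> :: real and w :: "'a \<Rightarrow> real"
  assumes verts_nonempty: "verts G \<noteq> {}"
    and c_pos: "c \<ge> 1"
    and coloring: "proper_coloring G (c + 1) col"
    and \<nu>_pos: "\<nu> > 0"
    and w_pos: "\<And>v. v \<in> verts G \<Longrightarrow> w v > 0"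
    and regular: "weight_regular G c col \<nu> w"
begin

lemma col_le: "v \<in> verts G \<Longrightarrow> col v \<le> c"
  using coloring by (auto simp: proper_coloring_def)

lemma apply_restrict_to_color:
  assumes "u \<in> verts G" "i \<le> c"
  shows "apply_on (verts G) (adjacency_matrix G) (restrict_to_color col w i) u =
    \<nu> * w u - \<nu> * restrict_to_color col w i u"
  using regular assms by (simp add: weight_regular_def restrict_to_color_def)

text \<open>Summing the identity over all \<open>c + 1\<close> colors, each vertex receives
  \<open>\<nu> * w u\<close> from the \<open>c\<close> colors other than its own.\<close>

lemma positive_eigenvector: "positive_graph_eigenvector G (real c * \<nu>) w"
proof -
  have "apply_on (verts G) (adjacency_matrix G) w u = real c * \<nu> * w u" if u: "u \<in> verts G" for u
  proof -
    have "apply_on (verts G) (adjacency_matrix G) w u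
        = (\<Sum>i\<le>c. apply_on (verts G) (adjacency_matrix G) (restrict_to_color col w i) u)"
      using col_le by (intro apply_on_sum_colors) auto
    also have "\<dots> = (\<Sum>i\<le>c. \<nu> * w u - (if i = col u then \<nu> * w u else 0))"
      by (intro sum.cong refl) (auto simp: apply_restrict_to_color u restrict_to_color_def)
    also have "\<dots> = (real c + 1) * (\<nu> * w u) - \<nu> * w u"
      using col_le[OF u] by (simp add: sum_subtractf)
    finally show ?thesis
      by (simp add: algebra_simps)
  qed
  then show ?thesis
    using verts_nonempty w_pos
    by (fastforce simp: positive_graph_eigenvector_def graph_eigenvector_iff_eigen_on eigen_on_def)
qed

text \<open>The weight \<open>\<nu> * w u\<close> is nonzero, so the sum producing it has a nonzero
  term. It follows that every color occurs and that there are arcs.\<close>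

lemma color_neighbour:
  assumes "u \<in> verts G" "i \<le> c" "i \<noteq> col u"
  obtains v where "v \<in> verts G" "col v = i" "u \<rightarrow> v"
proof -
  have "(\<Sum>v\<in>{v\<in>verts G. col v = i}. adjacency_matrix G u v * w v) = \<nu> * w u"
    using apply_restrict_to_color[OF assms(1,2)] assms(3)
    by (simp add: apply_on_restrict_to_color restrict_to_color_def)
  also have "\<dots> \<noteq> 0"
    using \<nu>_pos w_pos[OF assms(1)] by simp
  finally obtain v where "v \<in> verts G" "col v = i" "adjacency_matrix G u v \<noteq> 0"
    by (metis (mono_tags, lifting) mem_Collect_eq mult_zero_left sum.neutral)
  then show thesis
    using that by (auto simp: adjacency_matrix_def split: if_splits)
qed

lemma color_class_nonempty:
  assumes "i \<le> c"
  obtains v where "v \<in> verts G" "col v = i"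
  using verts_nonempty assms color_neighbour by (metis ex_in_conv)

lemma arcs_nonempty: "arcs G \<noteq> {}"
proof -
  obtain u where u: "u \<in> verts G" "col u = 0"
    using color_class_nonempty[of 0] by auto
  then obtain v where "u \<rightarrow> v"
    using color_neighbour[of u 1] c_pos by auto
  then show ?thesis
    by (auto simp: arcs_ends_conv)
qed

text \<open>In \<open>A (w_0 - w_1)\<close> the contributions of \<open>w\<close> cancel, leaving
  \<open>- \<nu> (w_0 - w_1)\<close>; hence \<open>- \<nu>\<close> is always an eigenvalue.\<close>

lemma least_eigenvector: "\<exists>f. graph_eigenvector G (- \<nu>) f"
proof -
  \<comment> \<open>The factor 1 puts \<open>f\<close> into the shape of
    \<open>apply_on_diff_scale\<close>.\<close>
  define f where "f v = restrict_to_color col w 0 v - 1 * restrict_to_color col w 1 v" for v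
  obtain u where u: "u \<in> verts G" "col u = 0"
    using color_class_nonempty[of 0] by auto
  then have "f u \<noteq> 0"
    using w_pos[of u] by (simp add: f_def restrict_to_color_def)
  moreover have "eigen_on (verts G) (adjacency_matrix G) (- \<nu>) f"
    using c_pos unfolding eigen_on_def f_def[abs_def] apply_on_diff_scale
    by (simp add: apply_restrict_to_color algebra_simps)
  ultimately show ?thesis
    using u by (auto simp: graph_eigenvector_iff_eigen_on)
qed

lemma min_graph_eigenvalue_le_neg: "min_graph_eigenvalue G \<le> - \<nu>"
  using least_eigenvector min_graph_eigenvalue_le by blast

text \<open>As \<open>\<theta>\<close> differs from \<open>c * \<nu>\<close>, \<open>z\<close> is
  orthogonal to \<open>w\<close>. Evaluating the product of \<open>z\<close> with
  \<open>A w_i\<close> in two ways then shows that \<open>\<theta>\<close> and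
  \<open>- \<nu>\<close> scale the product of \<open>z\<close> with \<open>w_i\<close> equally, so
  it is 0.\<close>

lemma eigenvector_orthogonal_color:
  assumes z: "graph_eigenvector G \<theta> z" and "\<theta> < - \<nu>" "i \<le> c"
  shows "(\<Sum>v\<in>color_class G col i. z v * w v) = 0"
proof -
  let ?S = "verts G" and ?A = "adjacency_matrix G" and ?r = "restrict_to_color col w i"
  have "\<theta> < real c * \<nu>"
    using assms(2) \<nu>_pos by (smt (verit) mult_nonneg_nonneg of_nat_0_le_iff)
  then have zw: "inner_on ?S z w = 0"
    using z positive_eigenvector adjacency_matrix_sym
    by (intro eigen_on_orthogonal[of ?S ?A \<theta> z "real c * \<nu>" w])
      (auto simp: positive_graph_eigenvector_def graph_eigenvector_iff_eigen_on)
  have "inner_on ?S z (apply_on ?S ?A ?r) = inner_on ?S z (\<lambda>v. \<nu> * w v - \<nu> * ?r v)"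
    using assms(3) by (intro inner_on_cong) (auto simp: apply_restrict_to_color)
  also have "\<dots> = - \<nu> * inner_on ?S z ?r"
    using zw by (simp add: inner_on_diff_scale_right inner_on_scale_right)
  finally have "inner_on ?S (apply_on ?S ?A z) ?r = - \<nu> * inner_on ?S z ?r"
    by (subst (asm) inner_on_apply_on_swap) (auto simp: adjacency_matrix_sym)
  moreover have "inner_on ?S (apply_on ?S ?A z) ?r = inner_on ?S (\<lambda>v. \<theta> * z v) ?r"
    using z by (intro inner_on_cong) (auto simp: graph_eigenvector_iff_eigen_on eigen_on_def)
  ultimately have "\<theta> * inner_on ?S z ?r = - \<nu> * inner_on ?S z ?r"
    by (simp add: inner_on_commute[of ?S _ ?r] inner_on_scale_right)
  then have "inner_on ?S z ?r = 0"
    using assms(2) by (simp only: mult_cancel_right) simp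
  then show ?thesis
    by (simp add: inner_on_def sum_restrict_to_color color_class_def)
qed

text \<open>The orthogonality conditions hold automatically for eigenvalues below
  \<open>- \<nu>\<close>, so excluding such eigenvectors excludes such eigenvalues
  altogether.\<close>

lemma min_graph_eigenvalue_eq_iff:
  "min_graph_eigenvalue G = - \<nu> \<longleftrightarrow> \<not> (\<exists>z \<theta>. graph_eigenvector G \<theta> z \<and> \<theta> < - \<nu> \<and>
     (\<forall>i\<le>c. (\<Sum>v\<in>color_class G col i. z v * w v) = 0))"
proof
  assume "min_graph_eigenvalue G = - \<nu>"
  then show "\<not> (\<exists>z \<theta>. graph_eigenvector G \<theta> z \<and> \<theta> < - \<nu> \<and>
      (\<forall>i\<le>c. (\<Sum>v\<in>color_class G col i. z v * w v) = 0))"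
    using min_graph_eigenvalue_le by fastforce
next
  assume none: "\<not> (\<exists>z \<theta>. graph_eigenvector G \<theta> z \<and> \<theta> < - \<nu> \<and>
      (\<forall>i\<le>c. (\<Sum>v\<in>color_class G col i. z v * w v) = 0))"
  obtain f where f: "graph_eigenvector G (min_graph_eigenvalue G) f"
    using verts_nonempty by (rule min_graph_eigenvalue_attained)
  have "\<not> min_graph_eigenvalue G < - \<nu>"
    using none f eigenvector_orthogonal_color by blast
  then show "min_graph_eigenvalue G = - \<nu>"
    using min_graph_eigenvalue_le_neg by simp
qed

text \<open>Hoffman's inequality for an optimal coloring and the eigenvector \<open>w\<close> shows
  that fewer than \<open>c + 1\<close> colors are impossible.\<close>

lemma chromatic_number_eq:
  assumes "- \<nu> \<le> min_graph_eigenvalue G"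
  shows "chromatic_number G = c + 1"
proof (rule antisym)
  show "chromatic_number G \<le> c + 1"
    using coloring by (rule chromatic_number_le)
  obtain col' where col': "proper_coloring G (chromatic_number G) col'"
    using coloring by (rule proper_coloring_chromatic_number)
  have min: "min_graph_eigenvalue G = - \<nu>"
    using assms min_graph_eigenvalue_le_neg by simp
  have "real c * \<nu> \<le> (real (card {..<chromatic_number G}) - 1) * \<nu>"
  proof (rule hoffman_inequality[OF finite_verts, of "adjacency_matrix G" col' _ _ w])
    show "rayleigh_bound (verts G) (adjacency_matrix G) (- \<nu>)"
      using rayleigh_bound_min_graph_eigenvalue verts_nonempty min by simp
    show "col' ` verts G \<subseteq> {..<chromatic_number G}"
      using col' by (auto simp: proper_coloring_def)
    show "eigen_on (verts G) (adjacency_matrix G) (real c * \<nu>) w" "\<exists>v\<in>verts G. w v \<noteq> 0"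
      using positive_eigenvector
      by (auto simp: positive_graph_eigenvector_def graph_eigenvector_iff_eigen_on)
    show "adjacency_matrix G u v = 0" if "col' u = col' v" for u v
      using col' that by (rule adjacency_matrix_proper_coloring)
  qed (simp_all add: adjacency_matrix_sym)
  then show "c + 1 \<le> chromatic_number G"
    using \<nu>_pos by simp
qed

lemma connected_hoffman_colorableI:
  assumes "- \<nu> \<le> min_graph_eigenvalue G" "Digraph_Component.connected G"
  shows "connected_hoffman_colorable G"
proof -
  have "min_graph_eigenvalue G = - \<nu>"
    using assms min_graph_eigenvalue_le_neg by simp
  then have "hoffman_bound G = 1 + real c"
    using \<nu>_pos max_graph_eigenvalue_positive[OF positive_eigenvector]
    by (simp add: hoffman_bound_def)
  then show ?thesis
    using assms arcs_nonempty chromatic_number_eq by (simp add: connected_hoffman_colorable_def)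
qed

text \<open>All neighbors of a vertex lie in its component, so the sums in the identity do not
  change on restriction.\<close>

lemma weight_regular_scc:
  assumes "H \<in> sccs"
  shows "weight_regular_graph H c col \<nu> w"
proof -
  interpret H: Digraph.graph H
    using assms by (rule graph_scc)
  have sub: "verts H \<subseteq> verts G"
    using assms by (rule sccs_subset_verts)
  show ?thesis
  proof
    show "verts H \<noteq> {}"
      using assms by (auto simp: sccs_def strongly_connected_def)
    show "c \<ge> 1" "\<nu> > 0"
      by (rule c_pos \<nu>_pos)+
    show "proper_coloring H (c + 1) col"
      using assms coloring by (rule proper_coloring_scc)
    show "w v > 0" if "v \<in> verts H" for v
      using that sub w_pos by blast
    have "apply_on (verts H) (adjacency_matrix H) f u = apply_on (verts G) (adjacency_matrix G) f u"
      if "u \<in> verts H" for f u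
      using apply_on_closed[OF sub scc_closed[OF assms] that] by (simp add: induce_verts_scc assms)
    then show "weight_regular H c col \<nu> w"
      using regular sub by (auto simp: weight_regular_def)
  qed
qed

text \<open>The parameters of the components agree because each component is weight-regular with the
  same data, and its least eigenvalue is squeezed between that of \<open>G\<close> and
  \<open>- \<nu>\<close>.\<close>

lemma hoffman_colorableI:
  assumes min: "min_graph_eigenvalue G = - \<nu>"
  shows "hoffman_colorable_with G (c + 1)"
proof -
  have comp: "connected_hoffman_colorable H \<and> max_graph_eigenvalue H = real c * \<nu>
      \<and> min_graph_eigenvalue H = - \<nu> \<and> chromatic_number H = c + 1" if H: "H \<in> sccs" for H
  proof -
    interpret H: weight_regular_graph H c col \<nu> w
      using H by (rule weight_regular_scc)
    have "- \<nu> \<le> min_graph_eigenvalue H"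
      using min_graph_eigenvalue_scc_ge[OF H] min by simp
    then show ?thesis
      using H.connected_hoffman_colorableI connected_scc[OF H] H.min_graph_eigenvalue_le_neg
        H.max_graph_eigenvalue_positive[OF H.positive_eigenvector] H.chromatic_number_eq by simp
  qed
  have "hoffman_colorable G"
  proof (cases "Digraph_Component.connected G")
    case True
    then show ?thesis
      using connected_hoffman_colorableI min verts_nonempty by (simp add: hoffman_colorable_def)
  next
    case False
    then show ?thesis
      unfolding hoffman_colorable_def if_not_P[OF False] using comp verts_nonempty by simp
  qed
  then show ?thesis
    using chromatic_number_eq min by (simp add: hoffman_colorable_with_def)
qed

text \<open>Hoffman colorability expresses the positive eigenvalue as \<open>c\<close> times minus
  the least one; it also equals \<open>c * \<nu>\<close>, and \<open>c\<close> cancels.\<close>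

lemma hoffman_colorable_iff:
  "hoffman_colorable_with G (c + 1) \<longleftrightarrow> min_graph_eigenvalue G = - \<nu>"
proof
  assume hc: "hoffman_colorable_with G (c + 1)"
  then have "real c * \<nu> = real c * (- min_graph_eigenvalue G)"
    using hoffman_colorable_eigenvalue(2)[OF _ positive_eigenvector coloring]
    by (simp add: hoffman_colorable_with_def)
  then have "real c * (min_graph_eigenvalue G + \<nu>) = 0"
    by (simp add: distrib_left)
  then show "min_graph_eigenvalue G = - \<nu>"
    using c_pos by (simp add: eq_neg_iff_add_eq_0)
qed (rule hoffman_colorableI)

end

section \<open>Deriving the identity on \<open>G\<close> from \<open>T\<close> and the bipartite
  graphs \<open>H i\<close>\<close>

lemma (in Digraph.graph) bipartite_positive_eigenvalue:
  assumes pos: "positive_graph_eigenvector G \<theta> x"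
    and bip: "\<And>u v. u \<rightarrow> v \<Longrightarrow> u \<in> B \<longleftrightarrow> v \<notin> B"
  shows "\<theta> = - min_graph_eigenvalue G"
proof -
  \<comment> \<open>Changing the sign outside \<open>B\<close> negates the eigenvalue, and no
    eigenvalue exceeds \<open>\<theta>\<close> in absolute value.\<close>
  define f where "f v = (if v \<in> B then x v else - x v)" for v
  have "apply_on (verts G) (adjacency_matrix G) f u = - \<theta> * f u" if u: "u \<in> verts G" for u
  proof -
    have "adjacency_matrix G u v * f v = (if u \<in> B then - 1 else 1) * (adjacency_matrix G u v * x v)" for v
      using bip[of u v] by (auto simp: adjacency_matrix_def f_def)
    then have "apply_on (verts G) (adjacency_matrix G) f u
        = (if u \<in> B then - 1 else 1) * apply_on (verts G) (adjacency_matrix G) x u"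
      by (simp only: apply_on_def sum_distrib_left)
    then show ?thesis
      using pos u
      by (simp add: positive_graph_eigenvector_def graph_eigenvector_iff_eigen_on eigen_on_def f_def)
  qed
  moreover have "\<exists>v\<in>verts G. f v \<noteq> 0"
    using pos by (auto simp: f_def positive_graph_eigenvector_def graph_eigenvector_def)
  ultimately have "graph_eigenvector G (- \<theta>) f"
    by (simp add: graph_eigenvector_iff_eigen_on eigen_on_def)
  then have "min_graph_eigenvalue G = - \<theta>"
    using abs_eigenvalue_le_positive[OF pos] by (intro min_graph_eigenvalue_eqI) fastforce+
  then show ?thesis by simp
qed

text \<open>The equality case applies with any color set of the right size; for \<open>T\<close>
  this is \<open>{1..c}\<close>, not an initial segment.\<close>

lemma (in Digraph.graph) hoffman_colorable_weight_regular:
  assumes hc: "hoffman_colorable G" and pos: "positive_graph_eigenvector G \<theta> x"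
    and I: "finite I" "col ` verts G \<subseteq> I" "card I = chromatic_number G" "i \<in> I"
    and col: "proper_coloring G k col" and u: "u \<in> verts G"
  shows "apply_on (verts G) (adjacency_matrix G) (restrict_to_color col x i) u =
    (if col u = i then 0 else - min_graph_eigenvalue G * x u)"
proof (rule hoffman_equality[OF finite_verts, of "adjacency_matrix G"])
  show "eigen_on (verts G) (adjacency_matrix G) ((real (card I) - 1) * - min_graph_eigenvalue G) x"
    using hoffman_colorable_eigenvalue(2)[OF hc pos col] pos I
    by (simp add: positive_graph_eigenvector_def graph_eigenvector_iff_eigen_on)
  show "rayleigh_bound (verts G) (adjacency_matrix G) (- (- min_graph_eigenvalue G))"
    using rayleigh_bound_min_graph_eigenvalue u by auto
qed (use I u adjacency_matrix_proper_coloring[OF col] adjacency_matrix_sym in auto)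

theorem theorem4p1:
  fixes G T :: "('a, 'b) pre_digraph" and H :: "nat \<Rightarrow> ('a, 'b) pre_digraph"
    and c :: nat and col :: "'a \<Rightarrow> nat" and V :: "nat \<Rightarrow> 'a set"
    and x y :: "'a \<Rightarrow> real" and \<nu> :: real
  defines "V \<equiv> color_class G col"
    and "T \<equiv> G \<restriction> (\<Union>i\<in>{1..c}. V i)"
    and "H \<equiv> (\<lambda>i. G \<restriction> (V 0 \<union> V i))"
    and "\<nu> \<equiv> - min_graph_eigenvalue T"
  assumes "Digraph.graph G"
    and "proper_coloring G (c + 1) col"
    and "hoffman_colorable_with T c"
    and "\<exists>\<theta>. positive_graph_eigenvector T \<theta> x"
    and "\<forall>i\<in>{1..c}. min_graph_eigenvalue T = min_graph_eigenvalue (H i)"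
    and "\<forall>v\<in>V 0. y v > 0"
    and "\<forall>i\<in>{1..c}. \<exists>\<theta>. positive_graph_eigenvector (H i) \<theta> (override_on x y (V 0))"
  shows "positive_graph_eigenvector G (real c * \<nu>) (override_on x y (V 0)) \<and>
         (hoffman_colorable_with G (c + 1) \<longleftrightarrow> min_graph_eigenvalue G = min_graph_eigenvalue T) \<and>
         (min_graph_eigenvalue G = min_graph_eigenvalue T \<longleftrightarrow>
           \<not> (\<exists>z \<theta>. graph_eigenvector G \<theta> z \<and> \<theta> < min_graph_eigenvalue T \<and>
                (\<Sum>v\<in>V 0. z v * y v) = 0 \<and>
                (\<forall>i\<in>{1..c}. (\<Sum>v\<in>V i. z v * x v) = 0)))"
proof -
  note G_graph = assms(5) and coloring = assms(6) and T_hoffman = assms(7) and T_positive = assms(8)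
    and H_min = assms(9) and y_pos = assms(10) and H_positive = assms(11)
  interpret Digraph.graph G
    by (rule G_graph)
  let ?A = "adjacency_matrix G"
  define w where "w = override_on x y (V 0)"
  define W where "W = (\<Union>i\<in>{1..c}. V i)"
  have V: "V i = {v \<in> verts G. col v = i}" for i
    by (simp add: V_def color_class_def)
  have V_sub: "V i \<subseteq> verts G" for i
    by (auto simp: V)
  have T: "T = G \<restriction> W" and W_sub: "W \<subseteq> verts G"
    by (auto simp: T_def W_def V)
  have W: "v \<in> W \<longleftrightarrow> v \<in> verts G \<and> col v \<noteq> 0" for v
    using coloring by (auto simp: W_def V proper_coloring_def)
  have w0: "w v = y v" if "v \<in> V 0" for v
    using that by (simp add: w_def)
  have wi: "w v = x v" if "v \<in> V i" "i \<noteq> 0" for v i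
    using that by (auto simp: w_def V)
  interpret T: Digraph.graph T
    unfolding T using W_sub by (rule graph_induce_subgraph)
  \<comment> \<open>Color 0 does not occur on \<open>T\<close>; that only \<open>c\<close> colors
    are left enters later through the color set \<open>{1..c}\<close>.\<close>
  have T_col: "proper_coloring T (c + 1) col"
    unfolding T using coloring W_sub by (rule proper_coloring_induce_subgraph)
  have T_verts: "verts T = W"
    by (simp add: T)
  obtain \<theta> where \<theta>: "positive_graph_eigenvector T \<theta> x"
    using T_positive by blast
  have T_hc: "hoffman_colorable T" and T_chi: "chromatic_number T = c"
    using T_hoffman by (auto simp: hoffman_colorable_with_def)
  have W_ne: "W \<noteq> {}"
    using T_hc by (simp add: hoffman_colorable_def T_verts)
  then have c_pos: "c \<ge> 1"
    by (auto simp: W_def)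
  have \<nu>_pos: "\<nu> > 0"
    using T.hoffman_colorable_eigenvalue(1)[OF T_hc \<theta> T_col] by (simp add: \<nu>_def)
  have x_pos: "x v > 0" if "v \<in> W" for v
    using \<theta> that by (simp add: positive_graph_eigenvector_def T_verts)
  have w_pos: "w v > 0" if "v \<in> verts G" for v
  proof (cases "col v = 0")
    case True
    then have "v \<in> V 0"
      using that by (simp add: V)
    then show ?thesis
      using y_pos w0 by simp
  next
    case False
    then show ?thesis
      using that x_pos[of v] wi[of v "col v"] by (simp add: W V)
  qed
  have H_regular: "(\<Sum>v\<in>V 0. ?A u v * w v) + (\<Sum>v\<in>V i. ?A u v * w v) = \<nu> * w u"
    if i: "i \<in> {1..c}" and u: "u \<in> V 0 \<union> V i" for u i
  proof -
    have sub: "V 0 \<union> V i \<subseteq> verts G"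
      using V_sub by blast
    have Hi: "H i = G \<restriction> (V 0 \<union> V i)"
      by (simp add: H_def)
    interpret Hi: Digraph.graph "H i"
      unfolding Hi using sub by (rule graph_induce_subgraph)
    obtain \<eta> where \<eta>: "positive_graph_eigenvector (H i) \<eta> w"
      using H_positive i unfolding w_def by blast
    \<comment> \<open>Bipartiteness ties the unknown eigenvalue to the least one, which the
      hypothesis on \<open>H i\<close> identifies with \<open>- \<nu>\<close>.\<close>
    have "\<eta> = - min_graph_eigenvalue (H i)"
    proof (rule Hi.bipartite_positive_eigenvalue[OF \<eta>, where B = "V 0"])
      fix a b
      assume ab: "a \<rightarrow>\<^bsub>H i\<^esub> b"
      then have "a \<in> verts (H i)" "b \<in> verts (H i)"
        by (auto simp: arcs_ends_conv)
      then have "a \<in> V 0 \<union> V i" "b \<in> V 0 \<union> V i"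
        by (simp_all add: Hi)
      moreover have "col a \<noteq> col b"
        using ab coloring unfolding Hi
        by (auto simp: proper_coloring_def dest: dominates_induce_subgraphD)
      ultimately show "a \<in> V 0 \<longleftrightarrow> b \<notin> V 0"
        by (auto simp: V)
    qed
    then have "\<eta> = \<nu>"
      using H_min i by (simp add: \<nu>_def)
    then have "apply_on (V 0 \<union> V i) ?A w u = \<nu> * w u"
      using \<eta> u
      by (simp add: positive_graph_eigenvector_def graph_eigenvector_iff_eigen_on eigen_on_def Hi
          apply_on_adjacency_induce_subgraph)
    moreover have "V 0 \<inter> V i = {}" "finite (V 0)" "finite (V i)"
      using i by (auto simp: V)
    ultimately show ?thesis
      by (simp add: apply_on_def sum.union_disjoint)
  qed
  have same_color: "(\<Sum>v\<in>V i. ?A u v * w v) = 0" if "col u = i" for u i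
    using adjacency_matrix_proper_coloring[OF coloring] that by (intro sum.neutral) (auto simp: V)
  \<comment> \<open>The equality case of Hoffman's bound on \<open>T\<close>, transferred to
    \<open>G\<close>; on \<open>W\<close> the vector \<open>w\<close> is \<open>x\<close>.\<close>
  have T_regular: "(\<Sum>v\<in>V i. ?A u v * w v) = \<nu> * w u"
    if i: "i \<in> {1..c}" and u: "u \<in> W" "col u \<noteq> i" for u i
  proof -
    have "col ` W \<subseteq> {1..c}"
      using coloring by (fastforce simp: W proper_coloring_def)
    then have "apply_on W (adjacency_matrix T) (restrict_to_color col x i) u = \<nu> * x u"
      using T.hoffman_colorable_weight_regular[OF T_hc \<theta> _ _ _ i T_col] u
      by (simp add: T_verts T_chi \<nu>_def)
    then have "apply_on W ?A (restrict_to_color col x i) u = \<nu> * x u"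
      using u by (simp add: T apply_on_adjacency_induce_subgraph)
    then have "(\<Sum>v\<in>{v\<in>W. col v = i}. ?A u v * x v) = \<nu> * x u"
      using finite_subset[OF W_sub finite_verts] by (simp add: apply_on_restrict_to_color)
    moreover have "{v\<in>W. col v = i} = V i"
      using i by (auto simp: W V)
    moreover have "w u = x u"
      using u wi[of u "col u"] by (simp add: W V)
    ultimately show ?thesis
      using wi[of _ i] i by simp
  qed
  have regular: "(\<Sum>v\<in>V i. ?A u v * w v) = (if col u = i then 0 else \<nu> * w u)"
    if u: "u \<in> verts G" and i: "i \<le> c" for u i
  proof -
    \<comment> \<open>Sums into color 0 come from \<open>H (col u)\<close>, sums from a vertex of
      color 0 from \<open>H i\<close>; in both, the sum over the color of \<open>u\<close> itself
      vanishes. Two distinct nonzero colors are handled by \<open>T\<close>.\<close>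
    consider "col u = i" | "col u \<noteq> i" "i = 0" | "col u \<noteq> i" "i \<noteq> 0" "col u = 0"
      | "col u \<noteq> i" "i \<noteq> 0" "col u \<noteq> 0"
      by blast
    then show ?thesis
    proof cases
      case 1
      then show ?thesis
        by (simp add: same_color)
    next
      case 2
      then have "col u \<in> {1..c}"
        using u coloring by (auto simp: proper_coloring_def)
      then show ?thesis
        using H_regular[of "col u" u] same_color[of u "col u"] 2 u by (simp add: V)
    next
      case 3
      then show ?thesis
        using H_regular[of i u] same_color[of u 0] u i by (simp add: V)
    next
      case 4
      then show ?thesis
        using T_regular[of i u] u i by (simp add: W)
    qed
  qed
  interpret weight_regular_graph G c col \<nu> w
  proof
    show "verts G \<noteq> {}"
      using W_ne W_sub by blast
    show "weight_regular G c col \<nu> w"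
      using regular by (simp add: weight_regular_def apply_on_restrict_to_color flip: V)
  qed (use c_pos coloring \<nu>_pos w_pos in auto)
  have min_T: "min_graph_eigenvalue T = - \<nu>"
    by (simp add: \<nu>_def)
  have V0_sum: "(\<Sum>v\<in>V 0. z v * w v) = (\<Sum>v\<in>V 0. z v * y v)" for z
    by (intro sum.cong refl) (simp add: w0)
  have Vi_sum: "(\<Sum>v\<in>V i. z v * w v) = (\<Sum>v\<in>V i. z v * x v)" if "i \<in> {1..c}" for z i
    using that by (intro sum.cong refl) (simp add: wi)
  \<comment> \<open>Color 0 is split off because \<open>w\<close> is \<open>y\<close> there and
    \<open>x\<close> on the other colors.\<close>
  have orth: "(\<forall>i\<le>c. (\<Sum>v\<in>color_class G col i. z v * w v) = 0) \<longleftrightarrow>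
      (\<Sum>v\<in>V 0. z v * y v) = 0 \<and> (\<forall>i\<in>{1..c}. (\<Sum>v\<in>V i. z v * x v) = 0)" for z
  proof -
    have "(\<forall>i\<le>c. P i) \<longleftrightarrow> P 0 \<and> (\<forall>i\<in>{1..c}. P i)" for P
      by (metis atLeastAtMost_iff le0 less_one linorder_not_le)
    then show ?thesis
      using V0_sum Vi_sum by (simp add: V_def)
  qed
  show ?thesis
    using positive_eigenvector[unfolded w_def] hoffman_colorable_iff
      min_graph_eigenvalue_eq_iff[unfolded orth]
    unfolding min_T by blast
qed

end
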